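(* Let $S\in\mathcal{IC}$ be an idempotent covered semigroup, let $\mathcal{P}$ be any (isomorphism-invariant) group property and let $\mathcal{Q}$ be any (isomorphism-invariant) semigroup property. (i) The subgroups [maximal subgroups] of $S$ all have property $\mathcal{P}$ if and only if the subgroups [maximal subgroups] of $T(S)$ all have property $\mathcal{P}$. (ii) The local submonoids of $S$ all have property $\mathcal{Q}$ if and only if the local submonoids of $T(S)$ all have property $\mathcal{Q}$.
   Context: For a semigroup $S$, $E(S)$ denotes its set of idempotents, and $S^1$ denotes $S$ itself if $S$ is a monoid, and otherwise $S$ with an identity $1$ adjoined. $S$ is idempotent covered ($S\in\mathcal{IC}$) if for every $s\in S$ there are $e,f\in E(S)$ with $se=s=fs$. The local submonoids of $S$ are the subsemigroups $eSe$ with $e\in E(S)$. The maximal subgroups of $S$ are the $\mathcal{H}$-classes of its idempotents. Let $R_2=\{\sigma,\tau\}$ be the two-element right-zero semigroup, and let $T*R_2$ be the set $S\times S\times R_2$ with product $(t_1,s_1,\sigma)(t_2,s_2,\alpha_2)=(t_1s_2,\,s_1s_2,\,\alpha_2)$ and $(t_1,s_1,\tau)(t_2,s_2,\alpha_2)=(t_1t_2,\,s_1t_2,\,\alpha_2)$ (a semidirect product of $T=S\times S$ by $R_2$). Let $E=\{(s,t,\alpha)\in E(T*R_2):\ s\in S^1t\}$ and $T(S)=\langle E\rangle$, the subsemigroup generated by $E$; for $S\in\mathcal{IC}$ one has $T(S)=\{(s,t,\alpha)\in T*R_2: s\in S^1t\}$. *)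

theory Defs
  imports "HOL-Algebra.Group"
begin

section \<open>Semigroups with an explicit carrier\<close>

record 'a sgrp = "'a partial_object" +
  smul :: "'a \<Rightarrow> 'a \<Rightarrow> 'a" (infixl \<open>\<cdot>\<index>\<close> 70)

locale sgrp =
  fixes S :: "('a, 'b) sgrp_scheme" (structure)
  assumes smul_closed: "x \<in> carrier S \<Longrightarrow> y \<in> carrier S \<Longrightarrow> x \<cdot> y \<in> carrier S"
    and smul_assoc: "x \<in> carrier S \<Longrightarrow> y \<in> carrier S \<Longrightarrow> z \<in> carrier S \<Longrightarrow>
      (x \<cdot> y) \<cdot> z = x \<cdot> (y \<cdot> z)"

definition sgrp_iso :: "('a, 'm) sgrp_scheme \<Rightarrow> ('b, 'n) sgrp_scheme \<Rightarrow> ('a \<Rightarrow> 'b) set" where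
  "sgrp_iso S T = {h. bij_betw h (carrier S) (carrier T) \<and>
     (\<forall>x\<in>carrier S. \<forall>y\<in>carrier S. h (x \<cdot>\<^bsub>S\<^esub> y) = h x \<cdot>\<^bsub>T\<^esub> h y)}"

definition idempotents :: "'a sgrp \<Rightarrow> 'a set" where
  "idempotents S = {e \<in> carrier S. e \<cdot>\<^bsub>S\<^esub> e = e}"

definition idempotent_covered :: "'a sgrp \<Rightarrow> bool" where
  "idempotent_covered S \<longleftrightarrow>
     (\<forall>s\<in>carrier S. \<exists>e\<in>idempotents S. \<exists>f\<in>idempotents S. s \<cdot>\<^bsub>S\<^esub> e = s \<and> f \<cdot>\<^bsub>S\<^esub> s = s)"

definition has_identity :: "'a sgrp \<Rightarrow> bool" where
  "has_identity S \<longleftrightarrow> (\<exists>u\<in>carrier S. \<forall>x\<in>carrier S. u \<cdot>\<^bsub>S\<^esub> x = x \<and> x \<cdot>\<^bsub>S\<^esub> u = x)"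

(* S^1: an element s of S is represented by Some s; None is the adjoined identity and belongs
   to the carrier only if S is not already a monoid. *)

fun option_mult :: "('a \<Rightarrow> 'a \<Rightarrow> 'a) \<Rightarrow> 'a option \<Rightarrow> 'a option \<Rightarrow> 'a option" where
  "option_mult f None y = y"
| "option_mult f (Some x) None = Some x"
| "option_mult f (Some x) (Some y) = Some (f x y)"

definition adjoin_one :: "'a sgrp \<Rightarrow> 'a option sgrp" where
  "adjoin_one S =
     \<lparr>carrier = (if has_identity S then Some ` carrier S else insert None (Some ` carrier S)),
      smul = option_mult (smul S)\<rparr>"

(* S^1 t and t S^1, as subsets of S *)

definition left_principal :: "'a sgrp \<Rightarrow> 'a \<Rightarrow> 'a set" where
  "left_principal S t =
     {s \<in> carrier S. \<exists>u\<in>carrier (adjoin_one S). Some s = u \<cdot>\<^bsub>adjoin_one S\<^esub> Some t}"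

definition right_principal :: "'a sgrp \<Rightarrow> 'a \<Rightarrow> 'a set" where
  "right_principal S t =
     {s \<in> carrier S. \<exists>u\<in>carrier (adjoin_one S). Some s = Some t \<cdot>\<^bsub>adjoin_one S\<^esub> u}"

lemma left_principal_iff:
  assumes "sgrp S" "t \<in> carrier S"
  shows "s \<in> left_principal S t \<longleftrightarrow> s = t \<or> (\<exists>u\<in>carrier S. s = u \<cdot>\<^bsub>S\<^esub> t)"
proof (cases "has_identity S")
  case True
  then obtain v where "v \<in> carrier S" "\<forall>x\<in>carrier S. v \<cdot>\<^bsub>S\<^esub> x = x \<and> x \<cdot>\<^bsub>S\<^esub> v = x"
    unfolding has_identity_def by blast
  with True show ?thesis
    using assms(2) sgrp.smul_closed[OF assms(1)]
    by (auto simp: left_principal_def adjoin_one_def) metis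
next
  case False
  then show ?thesis
    using assms(2) sgrp.smul_closed[OF assms(1)]
    by (auto simp: left_principal_def adjoin_one_def)
qed

lemma right_principal_iff:
  assumes "sgrp S" "t \<in> carrier S"
  shows "s \<in> right_principal S t \<longleftrightarrow> s = t \<or> (\<exists>u\<in>carrier S. s = t \<cdot>\<^bsub>S\<^esub> u)"
proof (cases "has_identity S")
  case True
  then obtain v where "v \<in> carrier S" "\<forall>x\<in>carrier S. v \<cdot>\<^bsub>S\<^esub> x = x \<and> x \<cdot>\<^bsub>S\<^esub> v = x"
    unfolding has_identity_def by blast
  with True show ?thesis
    using assms(2) sgrp.smul_closed[OF assms(1)]
    by (auto simp: right_principal_def adjoin_one_def) metis
next
  case False
  then show ?thesis
    using assms(2) sgrp.smul_closed[OF assms(1)]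
    by (auto simp: right_principal_def adjoin_one_def)
qed

(* Green's relation H *)

definition H_class :: "'a sgrp \<Rightarrow> 'a \<Rightarrow> 'a set" where
  "H_class S a = {b \<in> carrier S. left_principal S b = left_principal S a \<and>
                                 right_principal S b = right_principal S a}"


section \<open>Local submonoids and subgroups\<close>

definition local_submonoid :: "'a sgrp \<Rightarrow> 'a \<Rightarrow> 'a sgrp" where
  "local_submonoid S e = \<lparr>carrier = {e \<cdot>\<^bsub>S\<^esub> x \<cdot>\<^bsub>S\<^esub> e | x. x \<in> carrier S}, smul = smul S\<rparr>"

definition local_submonoids :: "'a sgrp \<Rightarrow> 'a sgrp set" where
  "local_submonoids S = local_submonoid S ` idempotents S"

definition restrict_monoid :: "'a sgrp \<Rightarrow> 'a set \<Rightarrow> 'a \<Rightarrow> 'a monoid" where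
  "restrict_monoid S H e = \<lparr>carrier = H, monoid.mult = smul S, one = e\<rparr>"

definition subgroups :: "'a sgrp \<Rightarrow> 'a monoid set" where
  "subgroups S = {restrict_monoid S H e | H e. H \<subseteq> carrier S \<and> group (restrict_monoid S H e)}"

definition maximal_subgroups :: "'a sgrp \<Rightarrow> 'a monoid set" where
  "maximal_subgroups S = {restrict_monoid S (H_class S e) e | e. e \<in> idempotents S}"


section \<open>The semigroup \<open>T(S)\<close>\<close>

datatype R2 = Sigma2 | Tau2

(* T * R2 for T = S x S: the semidirect product by the right-zero semigroup R2, in which
   Sigma2 acts on T by (t, s) |-> (s, s) and Tau2 by (t, s) |-> (t, t). *)

fun star_mult :: "'a sgrp \<Rightarrow> 'a \<times> 'a \<times> R2 \<Rightarrow> 'a \<times> 'a \<times> R2 \<Rightarrow> 'a \<times> 'a \<times> R2" where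
  "star_mult S (t1, s1, Sigma2) (t2, s2, \<alpha>2) = (t1 \<cdot>\<^bsub>S\<^esub> s2, s1 \<cdot>\<^bsub>S\<^esub> s2, \<alpha>2)"
| "star_mult S (t1, s1, Tau2) (t2, s2, \<alpha>2) = (t1 \<cdot>\<^bsub>S\<^esub> t2, s1 \<cdot>\<^bsub>S\<^esub> t2, \<alpha>2)"

definition star_R2 :: "'a sgrp \<Rightarrow> ('a \<times> 'a \<times> R2) sgrp" where
  "star_R2 S = \<lparr>carrier = carrier S \<times> carrier S \<times> UNIV, smul = star_mult S\<rparr>"

inductive_set generated :: "'a sgrp \<Rightarrow> 'a set \<Rightarrow> 'a set" for S X where
  incl: "x \<in> X \<Longrightarrow> x \<in> generated S X"
| mult: "x \<in> generated S X \<Longrightarrow> y \<in> generated S X \<Longrightarrow> x \<cdot>\<^bsub>S\<^esub> y \<in> generated S X"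

definition T_generators :: "'a sgrp \<Rightarrow> ('a \<times> 'a \<times> R2) set" where
  "T_generators S = {(s, t, \<alpha>) | s t \<alpha>. (s, t, \<alpha>) \<in> idempotents (star_R2 S) \<and> s \<in> left_principal S t}"

definition T_sgrp :: "'a sgrp \<Rightarrow> ('a \<times> 'a \<times> R2) sgrp" where
  "T_sgrp S = \<lparr>carrier = generated (star_R2 S) (T_generators S), smul = star_mult S\<rparr>"

lemma sgrp_star_R2:
  assumes "sgrp S"
  shows "sgrp (star_R2 S)"
proof -
  interpret sgrp S by fact
  have c: "star_mult S x y \<in> carrier S \<times> carrier S \<times> UNIV"
    if "x \<in> carrier S \<times> carrier S \<times> UNIV" "y \<in> carrier S \<times> carrier S \<times> UNIV" for x y
    using that by (cases "(S, x, y)" rule: star_mult.cases) (auto intro: smul_closed)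
  have "star_mult S (star_mult S x y) z = star_mult S x (star_mult S y z)"
    if "x \<in> carrier S \<times> carrier S \<times> UNIV" "y \<in> carrier S \<times> carrier S \<times> UNIV"
      "z \<in> carrier S \<times> carrier S \<times> UNIV" for x y z
  proof -
    obtain x1 x2 a where x: "x = (x1, x2, a)" by (cases x)
    obtain y1 y2 b where y: "y = (y1, y2, b)" by (cases y)
    obtain z1 z2 d where z: "z = (z1, z2, d)" by (cases z)
    show ?thesis using that unfolding x y z
      by (cases a; cases b) (auto simp: smul_assoc)
  qed
  with c show ?thesis by (simp only: star_R2_def sgrp_def partial_object.simps sgrp.simps) blast
qed

lemma sgrp_T_sgrp:
  assumes "sgrp S"
  shows "sgrp (T_sgrp S)"
proof -
  interpret R: sgrp "star_R2 S" by (rule sgrp_star_R2[OF assms])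
  have sub: "x \<in> carrier (star_R2 S)" if "x \<in> generated (star_R2 S) (T_generators S)" for x
    using that
    by induction (auto simp: T_generators_def idempotents_def intro: R.smul_closed)
  have m: "smul (star_R2 S) = star_mult S" by (simp add: star_R2_def)
  show ?thesis
    by (rule sgrp.intro)
      (auto simp: T_sgrp_def m[symmetric] intro: generated.mult R.smul_assoc sub)
qed


section \<open>Isomorphism-invariant properties\<close>

(* A property of groups makes sense for groups over every type, but a HOL predicate variable has
   one type only. A property is therefore represented by its instances at the two types involved:
   P for groups with elements in 'a and P' for groups with elements in 'b. Isomorphism invariance
   is required within each type and across the two. Such pairs are exactly the restrictions of
   isomorphism-invariant properties: given a pair, "isomorphic to a group over 'a satisfying P or
   to a group over 'b satisfying P'" is an isomorphism-invariant property with restrictions P and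
   P'. The same applies to semigroups. *)

definition groups_agree :: "('a monoid \<Rightarrow> bool) \<Rightarrow> ('b monoid \<Rightarrow> bool) \<Rightarrow> bool" where
  "groups_agree P P' \<longleftrightarrow> (\<forall>G H. group G \<longrightarrow> group H \<longrightarrow> G \<cong> H \<longrightarrow> (P G \<longleftrightarrow> P' H))"

definition invariant_group_property :: "('a monoid \<Rightarrow> bool) \<Rightarrow> ('b monoid \<Rightarrow> bool) \<Rightarrow> bool" where
  "invariant_group_property P P' \<longleftrightarrow> groups_agree P P \<and> groups_agree P' P' \<and> groups_agree P P'"

definition sgrps_agree :: "('a sgrp \<Rightarrow> bool) \<Rightarrow> ('b sgrp \<Rightarrow> bool) \<Rightarrow> bool" where
  "sgrps_agree Q Q' \<longleftrightarrow> (\<forall>S T. sgrp S \<longrightarrow> sgrp T \<longrightarrow> sgrp_iso S T \<noteq> {} \<longrightarrow> (Q S \<longleftrightarrow> Q' T))"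

definition invariant_sgrp_property :: "('a sgrp \<Rightarrow> bool) \<Rightarrow> ('b sgrp \<Rightarrow> bool) \<Rightarrow> bool" where
  "invariant_sgrp_property Q Q' \<longleftrightarrow> sgrps_agree Q Q \<and> sgrps_agree Q' Q' \<and> sgrps_agree Q Q'"

end

theory Submission
  imports Defs
begin

text \<open>
  Everything in the statement is local: a subgroup with identity \<open>e\<close> lies inside the local submonoid
  \<open>eSe\<close>, and the maximal subgroup at \<open>e\<close> is the group of units of \<open>eSe\<close>
  (\<open>H_class_eq_units\<close>). Hence all three equivalences hold for any two semigroups that have
  the same local submonoids up to isomorphism; this is the content of
  \<open>subgroups_property_transfer\<close>, \<open>maximal_subgroups_property_transfer\<close> and
  \<open>local_submonoids_property_transfer\<close>, each of which is one implication and is applied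
  in both directions.

  It remains to compare the local submonoids of \<open>S\<close> and of \<open>T(S)\<close>. In a product of
  \<open>T * R\<^sub>2\<close> the left factor \<open>(a, b, \<alpha>)\<close> sees only one coordinate of the right factor
  \<open>z\<close>, namely the second one if \<open>\<alpha> = \<sigma>\<close> and the first one if \<open>\<alpha> = \<tau>\<close>; both
  \<open>a\<close> and \<open>b\<close> are multiplied on the right by it. Let \<open>c\<close> be the coordinate of \<open>(a, b, \<alpha>)\<close>
  selected by \<open>\<alpha>\<close> itself. Then \<open>(a, b, \<alpha>)\<close> is idempotent iff \<open>ac = a\<close> and \<open>bc = b\<close>, which
  includes \<open>cc = c\<close>, and \<open>x \<mapsto> (ax, bx, \<alpha>)\<close> is an isomorphism of \<open>cSc\<close> onto the local
  submonoid at \<open>(a, b, \<alpha>)\<close>, whose inverse is the selection of the \<open>\<alpha>\<close>-coordinate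
  (\<open>lift_in_sgrp_iso\<close>). Every idempotent \<open>c\<close> of \<open>S\<close> arises in this way, from \<open>(c, c, \<sigma>)\<close>.
\<close>

section \<open>Local submonoids and their units\<close>

lemma carrier_local_submonoid_iff:
  assumes "sgrp S" "e \<in> idempotents S"
  shows "x \<in> carrier (local_submonoid S e) \<longleftrightarrow>
    x \<in> carrier S \<and> e \<cdot>\<^bsub>S\<^esub> x = x \<and> x \<cdot>\<^bsub>S\<^esub> e = x"
proof -
  interpret sgrp S by fact
  have e: "e \<in> carrier S" "e \<cdot>\<^bsub>S\<^esub> e = e" using assms(2) by (auto simp: idempotents_def)
  show ?thesis
  proof
    assume "x \<in> carrier (local_submonoid S e)"
    then obtain y where y: "y \<in> carrier S" "x = e \<cdot>\<^bsub>S\<^esub> y \<cdot>\<^bsub>S\<^esub> e"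
      by (auto simp: local_submonoid_def)
    have "e \<cdot>\<^bsub>S\<^esub> x = (e \<cdot>\<^bsub>S\<^esub> e) \<cdot>\<^bsub>S\<^esub> y \<cdot>\<^bsub>S\<^esub> e"
      using y e(1) by (simp add: smul_assoc smul_closed)
    moreover have "x \<cdot>\<^bsub>S\<^esub> e = e \<cdot>\<^bsub>S\<^esub> y \<cdot>\<^bsub>S\<^esub> (e \<cdot>\<^bsub>S\<^esub> e)"
      using y e(1) by (simp add: smul_assoc smul_closed)
    ultimately show "x \<in> carrier S \<and> e \<cdot>\<^bsub>S\<^esub> x = x \<and> x \<cdot>\<^bsub>S\<^esub> e = x"
      using y e by (simp add: smul_closed)
  next
    assume "x \<in> carrier S \<and> e \<cdot>\<^bsub>S\<^esub> x = x \<and> x \<cdot>\<^bsub>S\<^esub> e = x"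
    then show "x \<in> carrier (local_submonoid S e)"
      unfolding local_submonoid_def by (auto intro!: exI[of _ x])
  qed
qed

lemma smul_local_submonoid [simp]: "smul (local_submonoid S e) = smul S"
  by (simp add: local_submonoid_def)

lemma idempotent_in_local_submonoid:
  assumes "sgrp S" "e \<in> idempotents S"
  shows "e \<in> carrier (local_submonoid S e)"
  using carrier_local_submonoid_iff[OF assms, of e] assms(2) by (simp add: idempotents_def)

lemma sgrp_local_submonoid:
  assumes "sgrp S" "e \<in> idempotents S"
  shows "sgrp (local_submonoid S e)"
proof -
  interpret sgrp S by fact
  have e: "e \<in> carrier S" using assms(2) by (simp add: idempotents_def)
  note iff = carrier_local_submonoid_iff[OF assms]
  show ?thesis
  proof (rule sgrp.intro, unfold smul_local_submonoid iff)
    fix x y assume x: "x \<in> carrier S \<and> e \<cdot>\<^bsub>S\<^esub> x = x \<and> x \<cdot>\<^bsub>S\<^esub> e = x"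
      and y: "y \<in> carrier S \<and> e \<cdot>\<^bsub>S\<^esub> y = y \<and> y \<cdot>\<^bsub>S\<^esub> e = y"
    have "e \<cdot>\<^bsub>S\<^esub> (x \<cdot>\<^bsub>S\<^esub> y) = x \<cdot>\<^bsub>S\<^esub> y" using smul_assoc[of e x y] e x y by simp
    moreover have "(x \<cdot>\<^bsub>S\<^esub> y) \<cdot>\<^bsub>S\<^esub> e = x \<cdot>\<^bsub>S\<^esub> y" using smul_assoc[of x y e] e x y by simp
    ultimately show "x \<cdot>\<^bsub>S\<^esub> y \<in> carrier S \<and> e \<cdot>\<^bsub>S\<^esub> (x \<cdot>\<^bsub>S\<^esub> y) = x \<cdot>\<^bsub>S\<^esub> y \<and> (x \<cdot>\<^bsub>S\<^esub> y) \<cdot>\<^bsub>S\<^esub> e = x \<cdot>\<^bsub>S\<^esub> y"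
      using x y by (simp add: smul_closed)
  qed (simp add: smul_assoc)
qed

definition local_units :: "'a sgrp \<Rightarrow> 'a \<Rightarrow> 'a set" where
  "local_units S e = {x \<in> carrier (local_submonoid S e).
     \<exists>y\<in>carrier (local_submonoid S e). x \<cdot>\<^bsub>S\<^esub> y = e \<and> y \<cdot>\<^bsub>S\<^esub> x = e}"

lemma left_principal_eqI:
  assumes "sgrp S" "x \<in> carrier S" "e \<in> carrier S" "y \<in> carrier S" "x \<cdot>\<^bsub>S\<^esub> e = x" "y \<cdot>\<^bsub>S\<^esub> x = e"
  shows "left_principal S x = left_principal S e"
proof -
  interpret sgrp S by fact
  have "s \<in> left_principal S x \<longleftrightarrow> s \<in> left_principal S e" for s
    unfolding left_principal_iff[OF assms(1,2)] left_principal_iff[OF assms(1,3)]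
    using assms by (metis smul_assoc smul_closed)
  then show ?thesis by blast
qed

lemma right_principal_eqI:
  assumes "sgrp S" "x \<in> carrier S" "e \<in> carrier S" "y \<in> carrier S" "e \<cdot>\<^bsub>S\<^esub> x = x" "x \<cdot>\<^bsub>S\<^esub> y = e"
  shows "right_principal S x = right_principal S e"
proof -
  interpret sgrp S by fact
  have "s \<in> right_principal S x \<longleftrightarrow> s \<in> right_principal S e" for s
    unfolding right_principal_iff[OF assms(1,2)] right_principal_iff[OF assms(1,3)]
    using assms by (metis smul_assoc smul_closed)
  then show ?thesis by blast
qed

text \<open>
  If \<open>b\<close> is \<open>\<H>\<close>-related to \<open>e\<close>, then \<open>e = vb = bw\<close> for some \<open>v\<close>, \<open>w\<close>; cut down to \<open>eSe\<close>,
  these are a left and a right inverse of \<open>b\<close>, hence equal.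
\<close>

lemma H_class_eq_units:
  assumes "sgrp S" "e \<in> idempotents S"
  shows "H_class S e = local_units S e"
proof -
  interpret sgrp S by fact
  have e: "e \<in> carrier S" "e \<cdot>\<^bsub>S\<^esub> e = e" using assms(2) by (auto simp: idempotents_def)
  note iff = carrier_local_submonoid_iff[OF assms]
  show ?thesis
  proof (intro equalityI subsetI)
    fix b assume "b \<in> H_class S e"
    then have b: "b \<in> carrier S" and l: "left_principal S b = left_principal S e"
      and r: "right_principal S b = right_principal S e" by (auto simp: H_class_def)
    note li = left_principal_iff[OF assms(1)] and ri = right_principal_iff[OF assms(1)]
    have be: "b \<cdot>\<^bsub>S\<^esub> e = b"
      using l li[OF b, of b] li[OF e(1), of b] e b by (metis smul_assoc)
    have eb: "e \<cdot>\<^bsub>S\<^esub> b = b"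
      using r ri[OF b, of b] ri[OF e(1), of b] e b by (metis smul_assoc)
    obtain v where v: "v \<in> carrier S" "v \<cdot>\<^bsub>S\<^esub> b = e"
      using l li[OF b, of e] li[OF e(1), of e] e by metis
    obtain w where w: "w \<in> carrier S" "b \<cdot>\<^bsub>S\<^esub> w = e"
      using r ri[OF b, of e] ri[OF e(1), of e] e by metis
    define y where "y = e \<cdot>\<^bsub>S\<^esub> v \<cdot>\<^bsub>S\<^esub> e"
    define z where "z = e \<cdot>\<^bsub>S\<^esub> w \<cdot>\<^bsub>S\<^esub> e"
    have y: "y \<in> carrier (local_submonoid S e)" and z: "z \<in> carrier (local_submonoid S e)"
      using v w by (auto simp: y_def z_def local_submonoid_def)
    have yb: "y \<cdot>\<^bsub>S\<^esub> b = e"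
      unfolding y_def using e b v eb by (simp add: smul_assoc smul_closed)
    have bz: "b \<cdot>\<^bsub>S\<^esub> z = e"
    proof -
      have "b \<cdot>\<^bsub>S\<^esub> z = (b \<cdot>\<^bsub>S\<^esub> e) \<cdot>\<^bsub>S\<^esub> w \<cdot>\<^bsub>S\<^esub> e"
        unfolding z_def using e(1) b w(1) by (simp add: smul_assoc smul_closed)
      then show ?thesis using be w e by simp
    qed
    have "y = y \<cdot>\<^bsub>S\<^esub> (b \<cdot>\<^bsub>S\<^esub> z)" using y bz by (simp add: iff)
    also have "\<dots> = (y \<cdot>\<^bsub>S\<^esub> b) \<cdot>\<^bsub>S\<^esub> z" using y z b by (simp add: iff smul_assoc)
    also have "\<dots> = z" using yb z by (simp add: iff)
    finally have "b \<cdot>\<^bsub>S\<^esub> y = e" using bz by simp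
    moreover have "b \<in> carrier (local_submonoid S e)" using b eb be by (simp add: iff)
    ultimately show "b \<in> local_units S e" using y yb unfolding local_units_def by blast
  next
    fix x assume "x \<in> local_units S e"
    then obtain y where "x \<in> carrier (local_submonoid S e)" "y \<in> carrier (local_submonoid S e)"
      "x \<cdot>\<^bsub>S\<^esub> y = e" "y \<cdot>\<^bsub>S\<^esub> x = e" unfolding local_units_def by blast
    then have "x \<in> carrier S" "e \<cdot>\<^bsub>S\<^esub> x = x" "x \<cdot>\<^bsub>S\<^esub> e = x" "y \<in> carrier S"
      "x \<cdot>\<^bsub>S\<^esub> y = e" "y \<cdot>\<^bsub>S\<^esub> x = e" by (simp_all add: iff)
    with e show "x \<in> H_class S e"
      by (simp add: H_class_def left_principal_eqI[OF assms(1), of x e y]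
          right_principal_eqI[OF assms(1), of x e y])
  qed
qed

lemma group_local_units:
  assumes "sgrp S" "e \<in> idempotents S"
  shows "group (restrict_monoid S (local_units S e) e)"
proof -
  interpret L: sgrp "local_submonoid S e" by (rule sgrp_local_submonoid[OF assms])
  have one: "e \<cdot>\<^bsub>S\<^esub> x = x" "x \<cdot>\<^bsub>S\<^esub> e = x" if "x \<in> carrier (local_submonoid S e)" for x
    using that by (auto simp: carrier_local_submonoid_iff[OF assms])
  note e = idempotent_in_local_submonoid[OF assms]
  note cl = L.smul_closed[simplified] and as = L.smul_assoc[simplified]
  show ?thesis
  proof (rule groupI, simp_all add: restrict_monoid_def)
    fix x y assume "x \<in> local_units S e" "y \<in> local_units S e"
    then obtain x' y' where x: "x \<in> carrier (local_submonoid S e)" "x' \<in> carrier (local_submonoid S e)"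
        "x \<cdot>\<^bsub>S\<^esub> x' = e" "x' \<cdot>\<^bsub>S\<^esub> x = e"
      and y: "y \<in> carrier (local_submonoid S e)" "y' \<in> carrier (local_submonoid S e)"
        "y \<cdot>\<^bsub>S\<^esub> y' = e" "y' \<cdot>\<^bsub>S\<^esub> y = e"
      by (auto simp: local_units_def)
    have "(x \<cdot>\<^bsub>S\<^esub> y) \<cdot>\<^bsub>S\<^esub> (y' \<cdot>\<^bsub>S\<^esub> x') = x \<cdot>\<^bsub>S\<^esub> (y \<cdot>\<^bsub>S\<^esub> y') \<cdot>\<^bsub>S\<^esub> x'"
      using x(1,2) y(1,2) by (simp add: as cl)
    moreover have "(y' \<cdot>\<^bsub>S\<^esub> x') \<cdot>\<^bsub>S\<^esub> (x \<cdot>\<^bsub>S\<^esub> y) = y' \<cdot>\<^bsub>S\<^esub> (x' \<cdot>\<^bsub>S\<^esub> x) \<cdot>\<^bsub>S\<^esub> y"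
      using x(1,2) y(1,2) by (simp add: as cl)
    ultimately have "(x \<cdot>\<^bsub>S\<^esub> y) \<cdot>\<^bsub>S\<^esub> (y' \<cdot>\<^bsub>S\<^esub> x') = e" "(y' \<cdot>\<^bsub>S\<^esub> x') \<cdot>\<^bsub>S\<^esub> (x \<cdot>\<^bsub>S\<^esub> y) = e"
      using x y by (simp_all add: one)
    then show "x \<cdot>\<^bsub>S\<^esub> y \<in> local_units S e"
      using cl[OF x(1) y(1)] cl[OF y(2) x(2)] unfolding local_units_def by blast
  next
    show "e \<in> local_units S e" using e one[OF e] by (auto simp: local_units_def)
  next
    fix x y z assume "x \<in> local_units S e" "y \<in> local_units S e" "z \<in> local_units S e"
    then show "x \<cdot>\<^bsub>S\<^esub> y \<cdot>\<^bsub>S\<^esub> z = x \<cdot>\<^bsub>S\<^esub> (y \<cdot>\<^bsub>S\<^esub> z)" by (simp add: local_units_def as)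
  next
    fix x assume "x \<in> local_units S e"
    then show "e \<cdot>\<^bsub>S\<^esub> x = x" by (simp add: local_units_def one)
  next
    fix x assume "x \<in> local_units S e"
    then show "\<exists>y\<in>local_units S e. y \<cdot>\<^bsub>S\<^esub> x = e" by (auto simp: local_units_def)
  qed
qed

lemma subgroup_in_local_submonoid:
  assumes "sgrp S" "H \<subseteq> carrier S" "group (restrict_monoid S H e)"
  shows "e \<in> idempotents S" "H \<subseteq> carrier (local_submonoid S e)"
proof -
  interpret G: group "restrict_monoid S H e" by fact
  have "e \<in> H" "e \<cdot>\<^bsub>S\<^esub> e = e"
    using G.one_closed G.l_one[OF G.one_closed] by (simp_all add: restrict_monoid_def)
  then show e: "e \<in> idempotents S" using assms(2) by (auto simp: idempotents_def)
  show "H \<subseteq> carrier (local_submonoid S e)"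
    using G.l_one G.r_one assms(2)
    by (auto simp: carrier_local_submonoid_iff[OF assms(1) e] restrict_monoid_def)
qed


section \<open>Transfer along isomorphic local submonoids\<close>

lemma sgrp_iso_sym:
  assumes "sgrp S" "h \<in> sgrp_iso S T"
  shows "inv_into (carrier S) h \<in> sgrp_iso T S"
proof -
  interpret sgrp S by fact
  let ?g = "inv_into (carrier S) h"
  have bij: "bij_betw h (carrier S) (carrier T)"
    using assms(2) by (simp add: sgrp_iso_def)
  have hom: "h (x \<cdot>\<^bsub>S\<^esub> y) = h x \<cdot>\<^bsub>T\<^esub> h y" if "x \<in> carrier S" "y \<in> carrier S" for x y
    using assms(2) that by (simp add: sgrp_iso_def)
  have "?g (x \<cdot>\<^bsub>T\<^esub> y) = ?g x \<cdot>\<^bsub>S\<^esub> ?g y" if "x \<in> carrier T" "y \<in> carrier T" for x y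
  proof -
    have g: "?g x \<in> carrier S" "?g y \<in> carrier S" "h (?g x) = x" "h (?g y) = y"
      using that bij_betwE[OF bij_betw_inv_into[OF bij]] by (simp_all add: bij_betw_inv_into_right[OF bij])
    then have "x \<cdot>\<^bsub>T\<^esub> y = h (?g x \<cdot>\<^bsub>S\<^esub> ?g y)" by (simp add: hom)
    then show ?thesis using g bij by (simp add: bij_betw_inv_into_left smul_closed)
  qed
  then show ?thesis using bij_betw_inv_into[OF bij] by (auto simp: sgrp_iso_def)
qed

definition local_submonoids_occur_in :: "'a sgrp \<Rightarrow> 'b sgrp \<Rightarrow> bool" where
  "local_submonoids_occur_in S T \<longleftrightarrow> (\<forall>e\<in>idempotents S. \<exists>f\<in>idempotents T.
     sgrp_iso (local_submonoid S e) (local_submonoid T f) \<noteq> {})"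

lemma local_iso_idempotent:
  assumes "sgrp S" "sgrp T" "e \<in> idempotents S" "f \<in> idempotents T"
    and h: "h \<in> sgrp_iso (local_submonoid S e) (local_submonoid T f)"
  shows "h e = f"
proof -
  have e: "e \<in> carrier (local_submonoid S e)" and f: "f \<in> carrier (local_submonoid T f)"
    using assms by (auto intro: idempotent_in_local_submonoid)
  obtain x where x: "x \<in> carrier (local_submonoid S e)" "h x = f"
  proof -
    have "f \<in> h ` carrier (local_submonoid S e)"
      using h f by (simp add: sgrp_iso_def bij_betw_def)
    then show ?thesis using that by blast
  qed
  have he: "h e \<in> carrier (local_submonoid T f)"
    using h e by (auto simp: sgrp_iso_def dest: bij_betwE)
  have "f = h (e \<cdot>\<^bsub>S\<^esub> x)" using x by (simp add: carrier_local_submonoid_iff[OF assms(1,3)])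
  also have "\<dots> = h e \<cdot>\<^bsub>T\<^esub> f" using h e x by (auto simp: sgrp_iso_def)
  also have "\<dots> = h e" using he by (simp add: carrier_local_submonoid_iff[OF assms(2,4)])
  finally show ?thesis by simp
qed

lemma local_iso_image_group:
  assumes "sgrp S" "sgrp T" "e \<in> idempotents S" "f \<in> idempotents T"
    and h: "h \<in> sgrp_iso (local_submonoid S e) (local_submonoid T f)"
    and H: "H \<subseteq> carrier (local_submonoid S e)" "group (restrict_monoid S H e)"
  shows "group (restrict_monoid T (h ` H) f)" (is ?group)
    and "restrict_monoid S H e \<cong> restrict_monoid T (h ` H) f" (is ?iso)
proof -
  interpret G: group "restrict_monoid S H e" by fact
  have hom: "h (x \<cdot>\<^bsub>S\<^esub> y) = h x \<cdot>\<^bsub>T\<^esub> h y" if "x \<in> H" "y \<in> H" for x y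
    using that h H(1) by (auto simp: sgrp_iso_def)
  have "h \<in> hom (restrict_monoid S H e) (restrict_monoid T (h ` H) f)"
    using hom by (auto simp: hom_def restrict_monoid_def)
  then have "group (restrict_monoid T (h ` H) f
      \<lparr>carrier := h ` H, one := h e\<rparr>)"
    using G.hom_imp_img_group[of h "restrict_monoid T (h ` H) f"]
    by (simp add: restrict_monoid_def)
  then show ?group
    by (simp add: restrict_monoid_def local_iso_idempotent[OF assms(1-5)])
  have "inj_on h H" using h H(1) by (auto simp: sgrp_iso_def bij_betw_def intro: inj_on_subset)
  then have "h \<in> iso (restrict_monoid S H e) (restrict_monoid T (h ` H) f)"
    using hom by (auto simp: iso_def hom_def restrict_monoid_def bij_betw_def)
  then show ?iso by (auto simp: is_iso_def)
qed

lemma local_iso_image_units: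
  assumes "sgrp S" "sgrp T" "e \<in> idempotents S" "f \<in> idempotents T"
    and h: "h \<in> sgrp_iso (local_submonoid S e) (local_submonoid T f)"
  shows "h ` local_units S e = local_units T f"
proof -
  note L = sgrp_local_submonoid[OF assms(1,3)]
  have bij: "bij_betw h (carrier (local_submonoid S e)) (carrier (local_submonoid T f))"
    and hom: "\<And>x y. x \<in> carrier (local_submonoid S e) \<Longrightarrow> y \<in> carrier (local_submonoid S e) \<Longrightarrow>
      h (x \<cdot>\<^bsub>S\<^esub> y) = h x \<cdot>\<^bsub>T\<^esub> h y"
    using h by (auto simp: sgrp_iso_def)
  note he = local_iso_idempotent[OF assms]
  have eq: "x \<cdot>\<^bsub>S\<^esub> y = e \<longleftrightarrow> h x \<cdot>\<^bsub>T\<^esub> h y = f"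
    if "x \<in> carrier (local_submonoid S e)" "y \<in> carrier (local_submonoid S e)" for x y
    using that hom[OF that] he bij_betw_imp_inj_on[OF bij] sgrp.smul_closed[OF L, of x y]
      idempotent_in_local_submonoid[OF assms(1,3)]
    by (metis inj_onD smul_local_submonoid)
  have "h ` carrier (local_submonoid S e) = carrier (local_submonoid T f)"
    using bij by (simp add: bij_betw_def)
  with eq show ?thesis
    unfolding local_units_def by (auto simp flip: \<open>h ` _ = _\<close>)
qed

lemma subgroups_property_transfer:
  assumes "sgrp S" "sgrp T" "local_submonoids_occur_in S T" "groups_agree P P'"
    and "\<forall>G\<in>subgroups T. P' G"
  shows "\<forall>G\<in>subgroups S. P G"
proof
  fix G assume "G \<in> subgroups S"
  then obtain H e where G: "G = restrict_monoid S H e" "H \<subseteq> carrier S"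
    and grp: "group (restrict_monoid S H e)" by (auto simp: subgroups_def)
  note e = subgroup_in_local_submonoid[OF assms(1) G(2) grp]
  obtain f h where f: "f \<in> idempotents T"
    and h: "h \<in> sgrp_iso (local_submonoid S e) (local_submonoid T f)"
    using assms(3) e(1) unfolding local_submonoids_occur_in_def by blast
  note im = local_iso_image_group[OF assms(1,2) e(1) f h e(2) grp]
  have "h ` H \<subseteq> carrier (local_submonoid T f)"
    using h e(2) by (auto simp: sgrp_iso_def dest: bij_betwE)
  then have "h ` H \<subseteq> carrier T" by (auto simp: carrier_local_submonoid_iff[OF assms(2) f])
  then have "restrict_monoid T (h ` H) f \<in> subgroups T"
    using im(1) unfolding subgroups_def by blast
  then have "P' (restrict_monoid T (h ` H) f)" using assms(5) by blast
  then show "P G" using assms(4) im grp unfolding G groups_agree_def by blast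
qed

lemma maximal_subgroups_property_transfer:
  assumes "sgrp S" "sgrp T" "local_submonoids_occur_in S T" "groups_agree P P'"
    and "\<forall>G\<in>maximal_subgroups T. P' G"
  shows "\<forall>G\<in>maximal_subgroups S. P G"
proof
  fix G assume "G \<in> maximal_subgroups S"
  then obtain e where e: "e \<in> idempotents S" and G: "G = restrict_monoid S (local_units S e) e"
    using H_class_eq_units[OF assms(1)] by (auto simp: maximal_subgroups_def)
  obtain f h where f: "f \<in> idempotents T"
    and h: "h \<in> sgrp_iso (local_submonoid S e) (local_submonoid T f)"
    using assms(3) e unfolding local_submonoids_occur_in_def by blast
  note grp = group_local_units[OF assms(1) e]
  have "local_units S e \<subseteq> carrier (local_submonoid S e)" by (auto simp: local_units_def)
  from local_iso_image_group[OF assms(1,2) e f h this grp]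
  have im: "group (restrict_monoid T (local_units T f) f)"
    "restrict_monoid S (local_units S e) e \<cong> restrict_monoid T (local_units T f) f"
    by (simp_all add: local_iso_image_units[OF assms(1,2) e f h])
  have "restrict_monoid T (local_units T f) f \<in> maximal_subgroups T"
    unfolding maximal_subgroups_def using f H_class_eq_units[OF assms(2) f, symmetric] by auto
  then have "P' (restrict_monoid T (local_units T f) f)" using assms(5) by blast
  then show "P G" using assms(4) im grp unfolding G groups_agree_def by blast
qed

lemma local_submonoids_property_transfer:
  assumes "sgrp S" "sgrp T" "local_submonoids_occur_in S T" "sgrps_agree Q Q'"
    and "\<forall>M\<in>local_submonoids T. Q' M"
  shows "\<forall>M\<in>local_submonoids S. Q M"
proof
  fix M assume "M \<in> local_submonoids S"
  then obtain e where e: "e \<in> idempotents S" "M = local_submonoid S e"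
    by (auto simp: local_submonoids_def)
  then obtain f where f: "f \<in> idempotents T"
    "sgrp_iso (local_submonoid S e) (local_submonoid T f) \<noteq> {}"
    using assms(3) unfolding local_submonoids_occur_in_def by blast
  have "Q' (local_submonoid T f)" using assms(5) f(1) by (auto simp: local_submonoids_def)
  then show "Q M"
    using assms(4) f e sgrp_local_submonoid[OF assms(1) e(1)] sgrp_local_submonoid[OF assms(2) f(1)]
    unfolding sgrps_agree_def by blast
qed

lemma groups_agree_sym:
  assumes "groups_agree P P'"
  shows "groups_agree P' P"
  using assms group.iso_sym unfolding groups_agree_def by blast

lemma sgrps_agree_sym:
  assumes "sgrps_agree Q Q'"
  shows "sgrps_agree Q' Q"
  using assms sgrp_iso_sym unfolding sgrps_agree_def by blast


section \<open>The local submonoids of \<open>T(S)\<close>\<close>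

text \<open>The coordinate of the right factor that a left factor with last component \<open>\<alpha>\<close> sees.\<close>

fun seen_coord :: "R2 \<Rightarrow> 'a \<times> 'a \<times> R2 \<Rightarrow> 'a" where
  "seen_coord Sigma2 (t, s, \<beta>) = s"
| "seen_coord Tau2 (t, s, \<beta>) = t"

lemma star_mult_seen_coord:
  "star_mult S (a, b, \<alpha>) z = (a \<cdot>\<^bsub>S\<^esub> seen_coord \<alpha> z, b \<cdot>\<^bsub>S\<^esub> seen_coord \<alpha> z, snd (snd z))"
  by (cases z; cases \<alpha>) auto

lemma seen_coord_smul:
  "seen_coord \<alpha> (a \<cdot>\<^bsub>S\<^esub> x, b \<cdot>\<^bsub>S\<^esub> x, \<beta>) = seen_coord \<alpha> (a, b, \<gamma>) \<cdot>\<^bsub>S\<^esub> x"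
  by (cases \<alpha>) auto

lemma seen_coord_diag [simp]: "seen_coord \<alpha> (x, x, \<beta>) = x"
  by (cases \<alpha>) auto

lemma seen_coord_closed:
  "a \<in> carrier S \<Longrightarrow> b \<in> carrier S \<Longrightarrow> seen_coord \<alpha> (a, b, \<beta>) \<in> carrier S"
  by (cases \<alpha>) auto

lemma smul_T_sgrp [simp]: "smul (T_sgrp S) = star_mult S"
  by (simp add: T_sgrp_def)

lemma T_sgrp_carrier_subset:
  assumes "sgrp S" "(a, b, \<alpha>) \<in> carrier (T_sgrp S)"
  shows "a \<in> carrier S" "b \<in> carrier S"
proof -
  interpret R: sgrp "star_R2 S" by (rule sgrp_star_R2[OF assms(1)])
  have "x \<in> carrier (star_R2 S)" if "x \<in> generated (star_R2 S) (T_generators S)" for x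
    using that by induction (auto simp: T_generators_def idempotents_def intro: R.smul_closed)
  then show "a \<in> carrier S" "b \<in> carrier S"
    using assms(2) by (auto simp: T_sgrp_def star_R2_def)
qed

text \<open>
  For \<open>x = cx = xc\<close> both \<open>(c, c, \<alpha>)\<close> and \<open>(x, c, \<sigma>)\<close> are generators of \<open>T(S)\<close>, and
  \<open>(x, x, \<alpha>) = (c, c, \<tau>) (x, c, \<sigma>) (c, c, \<alpha>)\<close>. These elements show the same coordinate \<open>x\<close> to
  every left factor, and they are all that is used about the size of \<open>T(S)\<close>.
\<close>

lemma diagonal_in_T_sgrp:
  assumes "sgrp S" "c \<in> idempotents S" "x \<in> carrier (local_submonoid S c)"
  shows "(x, x, \<alpha>) \<in> carrier (T_sgrp S)"
proof -
  have c: "c \<in> carrier S" "c \<cdot>\<^bsub>S\<^esub> c = c" using assms(2) by (auto simp: idempotents_def)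
  have x: "x \<in> carrier S" "c \<cdot>\<^bsub>S\<^esub> x = x" "x \<cdot>\<^bsub>S\<^esub> c = x"
    using assms by (auto simp: carrier_local_submonoid_iff)
  let ?X = "T_generators S"
  have gc: "(c, c, \<beta>) \<in> ?X" for \<beta>
    using c by (cases \<beta>)
      (auto simp: T_generators_def idempotents_def star_R2_def left_principal_iff[OF assms(1)])
  have "x \<in> left_principal S c"
    unfolding left_principal_iff[OF assms(1) c(1)] using x by metis
  then have gx: "(x, c, Sigma2) \<in> ?X"
    using c x by (auto simp: T_generators_def idempotents_def star_R2_def)
  have "star_mult S (star_mult S (c, c, Tau2) (x, c, Sigma2)) (c, c, \<alpha>)
      \<in> generated (star_R2 S) ?X"
    using generated.mult[OF generated.mult[OF generated.incl[OF gc[of Tau2]] generated.incl[OF gx]]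
        generated.incl[OF gc[of "\<alpha>"]], of "star_R2 S"] by (simp add: star_R2_def)
  then show ?thesis using x by (simp add: T_sgrp_def)
qed

lemma T_sgrp_idempotent:
  assumes "sgrp S" "(a, b, \<alpha>) \<in> idempotents (T_sgrp S)"
  defines "c \<equiv> seen_coord \<alpha> (a, b, \<alpha>)"
  shows "a \<cdot>\<^bsub>S\<^esub> c = a" "b \<cdot>\<^bsub>S\<^esub> c = b" "c \<in> idempotents S"
proof -
  have m: "(a, b, \<alpha>) \<in> carrier (T_sgrp S)" using assms(2) by (simp add: idempotents_def)
  show ab: "a \<cdot>\<^bsub>S\<^esub> c = a" "b \<cdot>\<^bsub>S\<^esub> c = b"
    using assms(2) by (auto simp: idempotents_def star_mult_seen_coord c_def)
  show "c \<in> idempotents S"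
    using ab T_sgrp_carrier_subset[OF assms(1) m]
    by (cases \<alpha>) (auto simp: idempotents_def c_def)
qed

text \<open>
  A product \<open>(a, b, \<alpha>) z (a, b, \<alpha>)\<close> equals \<open>(ax, bx, \<alpha>)\<close> where \<open>x\<close> is a coordinate of \<open>z\<close> times
  a coordinate of \<open>(a, b, \<alpha>)\<close>. Since \<open>a\<close>, \<open>b\<close> and hence \<open>x\<close> absorb \<open>c\<close> on the right, \<open>x\<close> may be
  replaced by \<open>cx \<in> cSc\<close>. Conversely \<open>z = (x, x, \<alpha>)\<close> realises every \<open>x \<in> cSc\<close>. The map has the
  seen coordinate as its inverse because \<open>cx = x\<close> on \<open>cSc\<close>.
\<close>

lemma lift_in_sgrp_iso:
  assumes "sgrp S" "(a, b, \<alpha>) \<in> idempotents (T_sgrp S)"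
  defines "c \<equiv> seen_coord \<alpha> (a, b, \<alpha>)"
  shows "(\<lambda>x. (a \<cdot>\<^bsub>S\<^esub> x, b \<cdot>\<^bsub>S\<^esub> x, \<alpha>)) \<in>
    sgrp_iso (local_submonoid S c) (local_submonoid (T_sgrp S) (a, b, \<alpha>))"
proof -
  interpret sgrp S by fact
  let ?h = "\<lambda>x. (a \<cdot>\<^bsub>S\<^esub> x, b \<cdot>\<^bsub>S\<^esub> x, \<alpha>)"
  let ?L = "local_submonoid S c" and ?M = "local_submonoid (T_sgrp S) (a, b, \<alpha>)"
  have m: "(a, b, \<alpha>) \<in> carrier (T_sgrp S)" using assms(2) by (simp add: idempotents_def)
  note ab = T_sgrp_carrier_subset[OF assms(1) m]
  note idem = T_sgrp_idempotent[OF assms(1,2), folded c_def]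
  have c: "c \<in> carrier S" using idem(3) by (simp add: idempotents_def)
  note L = carrier_local_submonoid_iff[OF assms(1) idem(3)]
  have seen: "seen_coord \<alpha> (?h x) = x" if "x \<in> carrier ?L" for x
    using that seen_coord_smul[of \<alpha> S a x b \<alpha> \<alpha>] by (simp add: c_def[symmetric] L)
  have sandwich: "star_mult S (star_mult S (a, b, \<alpha>) z) (a, b, \<alpha>) =
      ?h (seen_coord \<alpha> z \<cdot>\<^bsub>S\<^esub> seen_coord (snd (snd z)) (a, b, \<alpha>))"
    if "z \<in> carrier (T_sgrp S)" for z
  proof -
    have "seen_coord \<alpha> z \<in> carrier S" "seen_coord \<beta> (a, b, \<alpha>) \<in> carrier S" for \<beta>
      using that ab T_sgrp_carrier_subset[OF assms(1)]
      by (cases z; auto intro: seen_coord_closed)+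
    then show ?thesis using ab by (simp add: star_mult_seen_coord smul_assoc)
  qed
  have "?h ` carrier ?L = carrier ?M"
  proof (intro equalityI subsetI)
    fix y assume "y \<in> ?h ` carrier ?L"
    then obtain x where x: "x \<in> carrier ?L" "y = ?h x" by blast
    note z = diagonal_in_T_sgrp[OF assms(1) idem(3) x(1), of \<alpha>]
    have "y = star_mult S (star_mult S (a, b, \<alpha>) (x, x, \<alpha>)) (a, b, \<alpha>)"
      using x by (simp add: sandwich[OF z] c_def[symmetric] L)
    then show "y \<in> carrier ?M" using z by (auto simp: local_submonoid_def)
  next
    fix y assume "y \<in> carrier ?M"
    then obtain z where z: "z \<in> carrier (T_sgrp S)"
      "y = star_mult S (star_mult S (a, b, \<alpha>) z) (a, b, \<alpha>)"
      by (auto simp: local_submonoid_def)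
    define p where "p = seen_coord \<alpha> z"
    define r where "r = seen_coord (snd (snd z)) (a, b, \<alpha>)"
    have p: "p \<in> carrier S"
      using z(1) T_sgrp_carrier_subset[OF assms(1)]
      by (cases z) (auto simp: p_def intro: seen_coord_closed)
    have r: "r \<in> carrier S" "r \<cdot>\<^bsub>S\<^esub> c = r"
      using ab idem by (cases "snd (snd z)"; auto simp: r_def)+
    define x where "x = c \<cdot>\<^bsub>S\<^esub> (p \<cdot>\<^bsub>S\<^esub> r) \<cdot>\<^bsub>S\<^esub> c"
    have "x \<in> carrier ?L" using p r by (auto simp: x_def local_submonoid_def smul_closed)
    moreover have "y = ?h x"
    proof -
      have x': "x = c \<cdot>\<^bsub>S\<^esub> (p \<cdot>\<^bsub>S\<^esub> r)" using p r c by (simp add: x_def smul_assoc smul_closed)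
      have "a \<cdot>\<^bsub>S\<^esub> x = (a \<cdot>\<^bsub>S\<^esub> c) \<cdot>\<^bsub>S\<^esub> (p \<cdot>\<^bsub>S\<^esub> r)" "b \<cdot>\<^bsub>S\<^esub> x = (b \<cdot>\<^bsub>S\<^esub> c) \<cdot>\<^bsub>S\<^esub> (p \<cdot>\<^bsub>S\<^esub> r)"
        unfolding x' using ab c p r(1) by (simp_all only: smul_assoc smul_closed)
      then show ?thesis by (simp add: z(2) sandwich[OF z(1)] p_def[symmetric] r_def[symmetric] idem)
    qed
    ultimately show "y \<in> ?h ` carrier ?L" by blast
  qed
  moreover have "inj_on ?h (carrier ?L)" by (rule inj_on_inverseI[where g = "seen_coord \<alpha>"]) (rule seen)
  moreover have "?h (x \<cdot>\<^bsub>S\<^esub> y) = star_mult S (?h x) (?h y)"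
    if "x \<in> carrier ?L" "y \<in> carrier ?L" for x y
    unfolding star_mult_seen_coord using that ab by (simp add: seen L smul_assoc)
  ultimately show ?thesis by (simp add: sgrp_iso_def bij_betw_def)
qed

lemma local_submonoids_occur_in_T_sgrp:
  assumes "sgrp S"
  shows "local_submonoids_occur_in S (T_sgrp S)"
  unfolding local_submonoids_occur_in_def
proof
  fix e assume e: "e \<in> idempotents S"
  have "(e, e, Sigma2) \<in> carrier (T_sgrp S)"
    by (rule diagonal_in_T_sgrp[OF assms e idempotent_in_local_submonoid[OF assms e]])
  then have i: "(e, e, Sigma2) \<in> idempotents (T_sgrp S)"
    using e by (simp add: idempotents_def)
  show "\<exists>f\<in>idempotents (T_sgrp S). sgrp_iso (local_submonoid S e) (local_submonoid (T_sgrp S) f) \<noteq> {}"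
    using lift_in_sgrp_iso[OF assms i] i by auto
qed

lemma T_sgrp_local_submonoids_occur_in:
  assumes "sgrp S"
  shows "local_submonoids_occur_in (T_sgrp S) S"
  unfolding local_submonoids_occur_in_def
proof
  fix e assume e: "e \<in> idempotents (T_sgrp S)"
  obtain a b \<alpha> where abc: "e = (a, b, \<alpha>)" by (cases e)
  note i = e[unfolded abc]
  note c = T_sgrp_idempotent(3)[OF assms i]
  show "\<exists>f\<in>idempotents S. sgrp_iso (local_submonoid (T_sgrp S) e) (local_submonoid S f) \<noteq> {}"
    using sgrp_iso_sym[OF sgrp_local_submonoid[OF assms c] lift_in_sgrp_iso[OF assms i]] c
    unfolding abc by blast
qed

theorem corollary4p6:
  fixes S :: "'a sgrp"
    and P :: "'a monoid \<Rightarrow> bool" and P' :: "('a \<times> 'a \<times> R2) monoid \<Rightarrow> bool"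
    and Q :: "'a sgrp \<Rightarrow> bool" and Q' :: "('a \<times> 'a \<times> R2) sgrp \<Rightarrow> bool"
  assumes "sgrp S" and "idempotent_covered S"
    and "invariant_group_property P P'"
    and "invariant_sgrp_property Q Q'"
  shows "((\<forall>G\<in>subgroups S. P G) \<longleftrightarrow> (\<forall>G\<in>subgroups (T_sgrp S). P' G)) \<and>
         ((\<forall>G\<in>maximal_subgroups S. P G) \<longleftrightarrow> (\<forall>G\<in>maximal_subgroups (T_sgrp S). P' G)) \<and>
         ((\<forall>M\<in>local_submonoids S. Q M) \<longleftrightarrow> (\<forall>M\<in>local_submonoids (T_sgrp S). Q' M))"
proof -
  have P: "groups_agree P P'" "groups_agree P' P"
    using assms(3) by (auto simp: invariant_group_property_def intro: groups_agree_sym)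
  have Q: "sgrps_agree Q Q'" "sgrps_agree Q' Q"
    using assms(4) by (auto simp: invariant_sgrp_property_def intro: sgrps_agree_sym)
  note ST = assms(1) sgrp_T_sgrp[OF assms(1)] local_submonoids_occur_in_T_sgrp[OF assms(1)]
  note TS = sgrp_T_sgrp[OF assms(1)] assms(1) T_sgrp_local_submonoids_occur_in[OF assms(1)]
  show ?thesis
    using subgroups_property_transfer[OF ST P(1)] subgroups_property_transfer[OF TS P(2)]
      maximal_subgroups_property_transfer[OF ST P(1)] maximal_subgroups_property_transfer[OF TS P(2)]
      local_submonoids_property_transfer[OF ST Q(1)] local_submonoids_property_transfer[OF TS Q(2)]
    by blast
qed

end
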